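(* Let $\sigma,\kappa>0$, $q(t)=\kappa t$, $t\in[0,t_{\max}]$, and for each mode $i=1,\dots,N$ let $\mu_i>0$, $v_i>0$, $$c_i(t)=\frac{q(t)q'(t)}{\sigma^2+\mu_iq(t)^2},\qquad b_i(t)=-\mu_ic_i(t),\qquad g_i(t)^2=2\sigma^2c_i(t),\qquad \gamma_i(t)=\frac{\sigma^2\big(v_i+q(t)^2\big)}{\sigma^2+\mu_iq(t)^2}.$$ Then the Gaussian-reference component of the probability-flow ODE, $$\frac{dx_i}{dt}=\Big[b_i(t)+\frac{g_i(t)^2}{2\gamma_i(t)}\Big]x_i,$$ has the exact modewise propagator mapping a state at time $\tau$ to time $t$ given by $$\phi_i(t,\tau)=\sqrt{\frac{\gamma_i(t)}{\gamma_i(\tau)}},$$ i.e. every solution satisfies $x_i(t)=\phi_i(t,\tau)\,x_i(\tau)$ for all $t,\tau\in[0,t_{\max}]$.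
   Context: Here $\mu_i>0$ are the eigenvalues of the shifted normalized graph Laplacian $\boldsymbol{L}_\delta=\boldsymbol{U}\,\mathrm{diag}(\mu_1,\dots,\mu_N)\,\boldsymbol{U}^\top$ and $v_i>0$ are the graph-Fourier variances of a zero-mean Gaussian reference $\mathcal{N}(\boldsymbol{0},\boldsymbol{U}\,\mathrm{diag}(v_1,\dots,v_N)\,\boldsymbol{U}^\top)$. The forward process in mode $i$ is the linear SDE $dx_{t,i}=b_i(t)x_{t,i}\,dt+g_i(t)\,dW_{t,i}$, and $\gamma_i(t)$ is the variance at time $t$ in mode $i$ of the reference propagated under this SDE. The probability-flow ODE with score $s_i$ is $\frac{dx_i}{dt}=b_i(t)x_i-\frac12g_i(t)^2s_i$; its Gaussian-reference component is obtained by inserting the reference score $s_i=-x_i/\gamma_i(t)$. *)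

theory Defs
  imports "HOL-Analysis.Analysis"
begin

text \<open>
  Coefficients of a single graph-Fourier mode with eigenvalue \<open>\<mu>\<close> and reference variance \<open>v\<close>,
  for an arbitrary schedule \<open>q\<close>.  The forward SDE of the mode is
  \<open>dx = b(t) x dt + g(t) dW\<close>, where \<open>g\<close> is constrained only through \<open>g(t)^2 = 2 \<sigma>^2 c(t)\<close>.
\<close>

definition mode_c :: "(real \<Rightarrow> real) \<Rightarrow> real \<Rightarrow> real \<Rightarrow> real \<Rightarrow> real" where
  "mode_c q \<sigma> \<mu> t = q t * deriv q t / (\<sigma>^2 + \<mu> * (q t)^2)"

definition mode_b :: "(real \<Rightarrow> real) \<Rightarrow> real \<Rightarrow> real \<Rightarrow> real \<Rightarrow> real" where
  "mode_b q \<sigma> \<mu> t = - \<mu> * mode_c q \<sigma> \<mu> t"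

definition mode_var :: "(real \<Rightarrow> real) \<Rightarrow> real \<Rightarrow> real \<Rightarrow> real \<Rightarrow> real \<Rightarrow> real" where
  "mode_var q \<sigma> \<mu> v t = \<sigma>^2 * (v + (q t)^2) / (\<sigma>^2 + \<mu> * (q t)^2)"

definition pf_rhs ::
  "(real \<Rightarrow> real) \<Rightarrow> (real \<Rightarrow> real) \<Rightarrow> (real \<Rightarrow> real \<Rightarrow> real) \<Rightarrow> real \<Rightarrow> real \<Rightarrow> real" where
  "pf_rhs b g s t x = b t * x - 1/2 * (g t)^2 * s t x"

text \<open>Score of the centred Gaussian with variance \<open>\<gamma> t\<close>.\<close>

definition gaussian_score :: "(real \<Rightarrow> real) \<Rightarrow> real \<Rightarrow> real \<Rightarrow> real" where
  "gaussian_score \<gamma> t x = - x / \<gamma> t"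

text \<open>Derivatives are taken relative to \<open>T\<close>, i.e. one-sided at the endpoints of an interval.\<close>

definition ode_solution :: "real set \<Rightarrow> (real \<Rightarrow> real \<Rightarrow> real) \<Rightarrow> (real \<Rightarrow> real) \<Rightarrow> bool" where
  "ode_solution T f x \<longleftrightarrow> (\<forall>t\<in>T. (x has_real_derivative f t (x t)) (at t within T))"

text \<open>
  \<open>\<phi> t \<tau>\<close> maps states at time \<open>\<tau>\<close> to states at time \<open>t\<close>: propagating any state from any
  time \<open>\<tau>\<close> yields a solution through that state, and every solution arises in this way.
\<close>

definition is_propagator ::
  "real set \<Rightarrow> (real \<Rightarrow> real \<Rightarrow> real) \<Rightarrow> (real \<Rightarrow> real \<Rightarrow> real) \<Rightarrow> bool" where
  "is_propagator T f \<phi> \<longleftrightarrow>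
     (\<forall>\<tau>\<in>T. \<forall>\<xi>. ode_solution T f (\<lambda>t. \<phi> t \<tau> * \<xi>) \<and> \<phi> \<tau> \<tau> * \<xi> = \<xi>) \<and>
     (\<forall>x. ode_solution T f x \<longrightarrow> (\<forall>t\<in>T. \<forall>\<tau>\<in>T. x t = \<phi> t \<tau> * x \<tau>))"

end

(* The drift coefficient of the flow is the logarithmic derivative of sqrt gamma, so sqrt gamma
   itself solves the linear equation, and the quotient of any other solution by it is constant. *)
theory Submission
  imports Defs
begin

text \<open>A linear SDE with drift \<open>b x\<close> and noise \<open>g\<close> changes variances
  by \<gamma>' = 2 b \<gamma> + g^2. Dividing by 2 \<gamma> shows that the flow coefficient a = b +
  g^2 / (2 \<gamma>) is half the logarithmic derivative of \<gamma>, so sqrt \<gamma> solves x' = a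
  x. By linearity its multiples are solutions, and there are no others.
  \<open>is_propagator_sqrt_ratio\<close> turns \<gamma>' = 2 a \<gamma> into the propagator;
  \<open>has_real_derivative_mode_var\<close> verifies this equation for the explicit
  variance.\<close>

lemma is_propagator_sqrt_ratio:
  fixes a \<gamma> :: "real \<Rightarrow> real"
  assumes "convex T"
    and pos: "\<And>t. t \<in> T \<Longrightarrow> \<gamma> t > 0"
    and der: "\<And>t. t \<in> T \<Longrightarrow> (\<gamma> has_real_derivative 2 * a t * \<gamma> t) (at t within T)"
  shows "is_propagator T (\<lambda>t x. a t * x) (\<lambda>t \<tau>. sqrt (\<gamma> t / \<gamma> \<tau>))"
proof -
  have sqrt_der: "((\<lambda>s. sqrt (\<gamma> s)) has_real_derivative a t * sqrt (\<gamma> t)) (at t within T)"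
    if "t \<in> T" for t
  proof -
    have "inverse (sqrt (\<gamma> t)) / 2 * (2 * a t * \<gamma> t) = a t * (\<gamma> t / sqrt (\<gamma> t))"
      by (simp add: inverse_eq_divide)
    also have "\<dots> = a t * sqrt (\<gamma> t)"
      by (simp only: real_div_sqrt[OF less_imp_le[OF pos[OF that]]])
    finally show ?thesis
      using DERIV_chain2[where f = sqrt and g = \<gamma>, OF DERIV_real_sqrt[OF pos[OF that]] der[OF that]] by (simp only:)
  qed
  have "((\<lambda>s. sqrt (\<gamma> s / \<gamma> \<tau>) * \<xi>) has_real_derivative a t * (sqrt (\<gamma> t / \<gamma> \<tau>) * \<xi>))
      (at t within T)" if "t \<in> T" for t \<tau> \<xi>
    \<comment> \<open>For fixed \<tau> the candidate is the solution sqrt \<gamma> scaled by a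
      constant, chosen so that the value at \<tau> is \<xi>.\<close>
    using DERIV_cmult_right[OF sqrt_der[OF that], of "\<xi> / sqrt (\<gamma> \<tau>)"]
    by (simp add: real_sqrt_divide mult_ac)
  moreover have "sqrt (\<gamma> \<tau> / \<gamma> \<tau>) * \<xi> = \<xi>" if "\<tau> \<in> T" for \<tau> \<xi>
    using pos[OF that] by simp
  moreover have "x t = sqrt (\<gamma> t / \<gamma> \<tau>) * x \<tau>"
    if x: "\<And>t. t \<in> T \<Longrightarrow> (x has_real_derivative a t * x t) (at t within T)"
      and "t \<in> T" "\<tau> \<in> T" for x t \<tau>
  proof -
    \<comment> \<open>Uniqueness: with y = sqrt \<gamma>, the numerator x' y - x y' of the quotient
      rule is a x y - x a y = 0.\<close>
    have "((\<lambda>s. x s / sqrt (\<gamma> s)) has_real_derivative 0) (at s within T)" if "s \<in> T" for s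
      using DERIV_divide[OF x[OF that] sqrt_der[OF that]] pos[OF that] by (simp add: mult_ac)
    then have "\<exists>C. \<forall>s\<in>T. x s / sqrt (\<gamma> s) = C"
      by (rule has_field_derivative_zero_constant[OF \<open>convex T\<close>])
    then obtain C where C: "\<And>s. s \<in> T \<Longrightarrow> x s / sqrt (\<gamma> s) = C"
      by blast
    have "x t = sqrt (\<gamma> t) * C" "C = x \<tau> / sqrt (\<gamma> \<tau>)"
      using C[OF \<open>t \<in> T\<close>] C[OF \<open>\<tau> \<in> T\<close>] pos[OF \<open>t \<in> T\<close>] by auto
    then show ?thesis
      by (simp add: real_sqrt_divide)
  qed
  ultimately show ?thesis
    unfolding is_propagator_def ode_solution_def by blast
qed

lemma mode_var_pos:
  assumes "\<sigma> > 0" "\<mu> > 0" "v > 0"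
  shows "mode_var q \<sigma> \<mu> v t > 0"
  unfolding mode_var_def using assms by (intro divide_pos_pos mult_pos_pos add_pos_nonneg) auto

text \<open>The variance equation \<gamma>' = 2 b \<gamma> + g^2 with g^2 = 2 \<sigma>^2 c, written
  as \<gamma>' = 2 a \<gamma> to fit \<open>is_propagator_sqrt_ratio\<close>. It holds for any
  schedule differentiable at \<open>t\<close>.\<close>

lemma has_real_derivative_mode_var:
  fixes q :: "real \<Rightarrow> real"
  assumes "\<sigma> > 0" "\<mu> > 0" "v > 0" and "q differentiable at t"
  shows "(mode_var q \<sigma> \<mu> v has_real_derivative
    2 * (mode_b q \<sigma> \<mu> t + 2 * \<sigma>\<^sup>2 * mode_c q \<sigma> \<mu> t / (2 * mode_var q \<sigma> \<mu> v t)) * mode_var q \<sigma> \<mu> v t)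
    (at t within T)"
proof -
  define D where "D = \<sigma>\<^sup>2 + \<mu> * (q t)\<^sup>2"
  have "D > 0"
    unfolding D_def using assms by (intro add_pos_nonneg) auto
  have q: "(q has_real_derivative deriv q t) (at t within T)"
    using assms(4) DERIV_deriv_iff_real_differentiable has_field_derivative_at_within by blast
  have "(mode_var q \<sigma> \<mu> v has_real_derivative
      (\<sigma>\<^sup>2 * (2 * q t * deriv q t) * D - \<sigma>\<^sup>2 * (v + (q t)\<^sup>2) * (\<mu> * (2 * q t * deriv q t))) / (D * D))
      (at t within T)"
    unfolding mode_var_def D_def
    using \<open>D > 0\<close> by (auto intro!: derivative_eq_intros q simp: D_def)
  \<comment> \<open>Positivity of the variance lets the factor \<gamma> cancel the denominator in
    a.\<close>
  moreover have "2 * (mode_b q \<sigma> \<mu> t + 2 * \<sigma>\<^sup>2 * mode_c q \<sigma> \<mu> t / (2 * mode_var q \<sigma> \<mu> v t))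
        * mode_var q \<sigma> \<mu> v t
      = 2 * mode_b q \<sigma> \<mu> t * mode_var q \<sigma> \<mu> v t + 2 * \<sigma>\<^sup>2 * mode_c q \<sigma> \<mu> t"
    using mode_var_pos[OF assms(1-3), of q t] by (simp add: distrib_right distrib_left)
  \<comment> \<open>Both sides reduce to 2 \<sigma>^2 q q' (\<sigma>^2 - \<mu> v) / D^2, since D -
    \<mu> (v + q^2) = \<sigma>^2 - \<mu> v.\<close>
  moreover have "\<dots> = (\<sigma>\<^sup>2 * (2 * q t * deriv q t) * D
      - \<sigma>\<^sup>2 * (v + (q t)\<^sup>2) * (\<mu> * (2 * q t * deriv q t))) / (D * D)"
    unfolding mode_b_def mode_c_def mode_var_def D_def[symmetric]
    using \<open>D > 0\<close> by (simp add: field_simps)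
  ultimately show ?thesis
    by (simp only:)
qed

theorem mainTheorem4:
  fixes \<sigma> \<kappa> t_max :: real and N :: nat
    and \<mu> v :: "nat \<Rightarrow> real"
    and q :: "real \<Rightarrow> real"
    and b g \<gamma> :: "nat \<Rightarrow> real \<Rightarrow> real"
  assumes "\<sigma> > 0" and "\<kappa> > 0"
    and "q = (\<lambda>t. \<kappa> * t)"
    and "\<And>i. i \<in> {1..N} \<Longrightarrow> \<mu> i > 0"
    and "\<And>i. i \<in> {1..N} \<Longrightarrow> v i > 0"
    and "\<And>i t. i \<in> {1..N} \<Longrightarrow> t \<in> {0..t_max} \<Longrightarrow> b i t = mode_b q \<sigma> (\<mu> i) t"
    and "\<And>i t. i \<in> {1..N} \<Longrightarrow> t \<in> {0..t_max} \<Longrightarrow> (g i t)^2 = 2 * \<sigma>^2 * mode_c q \<sigma> (\<mu> i) t"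
    and "\<And>i t. i \<in> {1..N} \<Longrightarrow> t \<in> {0..t_max} \<Longrightarrow> \<gamma> i t = mode_var q \<sigma> (\<mu> i) (v i) t"
  shows "\<forall>i\<in>{1..N}.
     (\<forall>t\<in>{0..t_max}. \<forall>x. pf_rhs (b i) (g i) (gaussian_score (\<gamma> i)) t x
                           = (b i t + (g i t)^2 / (2 * \<gamma> i t)) * x) \<and>
     is_propagator {0..t_max}
       (\<lambda>t x. (b i t + (g i t)^2 / (2 * \<gamma> i t)) * x)
       (\<lambda>t \<tau>. sqrt (\<gamma> i t / \<gamma> i \<tau>))"
proof (intro ballI conjI)
  fix i t x assume "i \<in> {1..N}" "t \<in> {0..t_max}"
  show "\<forall>x. pf_rhs (b i) (g i) (gaussian_score (\<gamma> i)) t x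
      = (b i t + (g i t)^2 / (2 * \<gamma> i t)) * x"
    \<comment> \<open>The minus signs of the flow and of the Gaussian score cancel.\<close>
    by (simp add: pf_rhs_def gaussian_score_def distrib_right)
next
  fix i assume i: "i \<in> {1..N}"
  note coeffs = assms(1) assms(4)[OF i] assms(5)[OF i]
  show "is_propagator {0..t_max} (\<lambda>t x. (b i t + (g i t)^2 / (2 * \<gamma> i t)) * x)
      (\<lambda>t \<tau>. sqrt (\<gamma> i t / \<gamma> i \<tau>))"
  proof (rule is_propagator_sqrt_ratio)
    fix t assume t: "t \<in> {0..t_max}"
    show "\<gamma> i t > 0"
      unfolding assms(8)[OF i t] by (rule mode_var_pos[OF coeffs])
    have "q differentiable at t"
      unfolding assms(3) by simp
    \<comment> \<open>\<open>\<gamma> i\<close> is prescribed only on the interval, so the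
      derivative of \<open>mode_var\<close> is transferred within it; the radius 1 of the
      neighbourhood is arbitrary.\<close>
    then show "(\<gamma> i has_real_derivative 2 * (b i t + (g i t)^2 / (2 * \<gamma> i t)) * \<gamma> i t)
        (at t within {0..t_max})"
      unfolding assms(6)[OF i t] assms(7)[OF i t] assms(8)[OF i t]
      using assms(8)[OF i] t
      by (intro has_field_derivative_transform_within[OF
            has_real_derivative_mode_var[OF coeffs] zero_less_one]) auto
  qed simp
qed

end
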